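(* Let $N\ge1$, $\delta\in\mathbb{C}\setminus\{0,-r\}$, $\sigma=\delta/r$, and let $0\neq\omega=kv\in\mathbb{C}$. Then $\omega$ is a resonant frequency of the scattering problem $(\mathrm{SP}_\delta)$ if and only if $k$ is a zero of the function $f(\cdot;\sigma)$, analytic in $k$, defined by $$f(k;\sigma):=M_{tot}(k;\sigma)_{2,2}=\sum_{\boldsymbol\alpha\in\{-1,1\}^{2N-1}}(-1)^{\sum_{j=1}^{2N}j\,\epsilon_{\alpha_j,\alpha_{j-1}}}\left(\frac{1-\sigma}{1+\sigma}\right)^{\sum_{j=1}^{2N}\epsilon_{\alpha_j,\alpha_{j-1}}}e^{i\langle\boldsymbol\alpha,\boldsymbol t\rangle k},$$ where $\boldsymbol\alpha=(\alpha_1,\dots,\alpha_{2N-1})$, $\alpha_0=\alpha_{2N}=-1$, $\epsilon_{a,b}=1$ if $a\ne b$ and $\epsilon_{a,b}=0$ if $a=b$, and $\langle\boldsymbol\alpha,\boldsymbol t\rangle=\sum_{j=1}^{2N-1}\alpha_jt_j$.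
   Context: Setting. $x_1^-<x_1^+<x_2^-<x_2^+<\dots<x_N^-<x_N^+$ are real numbers, $D=\bigcup_{j=1}^N(x_j^-,x_j^+)$, $\ell_j=x_j^+-x_j^-$, $s_j=x_{j+1}^--x_j^+$. The constants $v,v_b>0$ are fixed and $r=v/v_b>0$. For $\omega\in\mathbb{C}$ put $k=\omega/v$ and $k_b=\omega/v_b=rk$. $w|_\pm(x)=\lim_{s\to0^+}w(x\pm s)$. The scattering problem $(\mathrm{SP}_\delta)$ at frequency $\omega$ is: $u''+k^2u=0$ on $\mathbb{R}\setminus \overline{D}$; $u''+k_b^2u=0$ on $D$; for all $1\le j\le N$: $u|_+(x_j^\pm)=u|_-(x_j^\pm)$, $u'|_+(x_j^-)=\delta\,u'|_-(x_j^-)$, $u'|_-(x_j^+)=\delta\,u'|_+(x_j^+)$; and $-u'-iku=0$ on $(-\infty,x_1^-)$, $u'-iku=0$ on $(x_N^+,\infty)$. $\omega$ is a resonant frequency if this problem has a non-trivial solution $u$. $\boldsymbol t=(t_1,\dots,t_{2N-1})=(r\ell_1,s_1,r\ell_2,s_2,\dots,r\ell_{N-1},s_{N-1},r\ell_N)\in\mathbb{R}_{>0}^{2N-1}$. For $z\in\mathbb{C}$, $$R(z)=\begin{pmatrix}\frac{1+z}2&\frac{1-z}2\\ \frac{1-z}2&\frac{1+z}2\end{pmatrix},\qquad L(z)=\begin{pmatrix}e^{iz}&0\\0&e^{-iz}\end{pmatrix},$$ $$M_{tot}(k;\sigma)=\frac{(4\sigma)^N}{(1+\sigma)^{2N}}R\!\left(\tfrac1\sigma\right)L(t_{2N-1}k)R(\sigma)L(t_{2N-2}k)\cdots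 R\!\left(\tfrac1\sigma\right)L(t_1k)R(\sigma)$$ (the factors $R(\sigma)$ and $R(1/\sigma)$ alternate, $2N$ of them in total, separated by $L(t_{2N-1}k),\dots,L(t_1k)$). *)

theory Defs
  imports "HOL-Analysis.Analysis"
begin

text \<open>The endpoints of the resonators are families \<open>xm, xp :: nat \<Rightarrow> real\<close>
  (for \<open>x\<^sub>j\<^sup>-\<close> and \<open>x\<^sub>j\<^sup>+\<close>), of which only the indices \<open>1, \<dots>, N\<close> are used.\<close>

definition resonators :: "nat \<Rightarrow> (nat \<Rightarrow> real) \<Rightarrow> (nat \<Rightarrow> real) \<Rightarrow> real set" where
  "resonators N xm xp = (\<Union>j\<in>{1..N}. {xm j<..<xp j})"

abbreviation vderiv :: "(real \<Rightarrow> complex) \<Rightarrow> real \<Rightarrow> complex" where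
  "vderiv u x \<equiv> vector_derivative u (at x)"

text \<open>\<open>u'' + \<kappa>\<^sup>2 u = 0\<close> on \<open>S\<close>, in the classical sense; only used for open \<open>S\<close>.\<close>

definition helmholtz_on :: "complex \<Rightarrow> real set \<Rightarrow> (real \<Rightarrow> complex) \<Rightarrow> bool" where
  "helmholtz_on \<kappa> S u \<longleftrightarrow>
     (\<forall>x\<in>S. u differentiable (at x) \<and> vderiv u differentiable (at x) \<and>
            vderiv (vderiv u) x + \<kappa>\<^sup>2 * u x = 0)"

text \<open>An equality between one-sided limits includes their existence.\<close>

definition scattering_solution ::
  "nat \<Rightarrow> (nat \<Rightarrow> real) \<Rightarrow> (nat \<Rightarrow> real) \<Rightarrow> real \<Rightarrow> real \<Rightarrow> complex \<Rightarrow> complex \<Rightarrow> (real \<Rightarrow> complex) \<Rightarrow> bool"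
where
  "scattering_solution N xm xp v vb \<delta> \<omega> u \<longleftrightarrow>
     (let k = \<omega> / of_real v; kb = \<omega> / of_real vb; D = resonators N xm xp in
       helmholtz_on k (- closure D) u \<and>
       helmholtz_on kb D u \<and>
       (\<forall>j\<in>{1..N}.
          (\<forall>x\<in>{xm j, xp j}. \<exists>a. (u \<longlongrightarrow> a) (at_right x) \<and> (u \<longlongrightarrow> a) (at_left x)) \<and>
          (\<exists>b. (vderiv u \<longlongrightarrow> \<delta> * b) (at_right (xm j)) \<and> (vderiv u \<longlongrightarrow> b) (at_left (xm j))) \<and>
          (\<exists>b. (vderiv u \<longlongrightarrow> \<delta> * b) (at_left (xp j)) \<and> (vderiv u \<longlongrightarrow> b) (at_right (xp j)))) \<and>
       (\<forall>x<xm 1. - vderiv u x - \<i> * k * u x = 0) \<and>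
       (\<forall>x>xp N. vderiv u x - \<i> * k * u x = 0))"

text \<open>The problem does not constrain the values of \<open>u\<close> at the interface points
  \<open>x\<^sub>j\<^sup>\<plusminus>\<close> themselves, so a solution is non-trivial if it does not vanish identically
  off these points.\<close>

definition resonant_frequency ::
  "nat \<Rightarrow> (nat \<Rightarrow> real) \<Rightarrow> (nat \<Rightarrow> real) \<Rightarrow> real \<Rightarrow> real \<Rightarrow> complex \<Rightarrow> complex \<Rightarrow> bool"
where
  "resonant_frequency N xm xp v vb \<delta> \<omega> \<longleftrightarrow>
     (\<exists>u. scattering_solution N xm xp v vb \<delta> \<omega> u \<and>
          (\<exists>x. x \<notin> xm ` {1..N} \<union> xp ` {1..N} \<and> u x \<noteq> 0))"

text \<open>\<open>tvec r xm xp (2j - 1) = r \<ell>\<^sub>j\<close> and \<open>tvec r xm xp (2j) = s\<^sub>j\<close>.\<close>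

definition tvec :: "real \<Rightarrow> (nat \<Rightarrow> real) \<Rightarrow> (nat \<Rightarrow> real) \<Rightarrow> nat \<Rightarrow> real" where
  "tvec r xm xp i =
     (if odd i then r * (xp ((i + 1) div 2) - xm ((i + 1) div 2))
      else xm (i div 2 + 1) - xp (i div 2))"

definition R_mat :: "complex \<Rightarrow> complex^2^2" where
  "R_mat z = vector [vector [(1 + z) / 2, (1 - z) / 2],
                     vector [(1 - z) / 2, (1 + z) / 2]]"

definition L_mat :: "complex \<Rightarrow> complex^2^2" where
  "L_mat z = vector [vector [exp (\<i> * z), 0],
                     vector [0, exp (- \<i> * z)]]"

text \<open>\<open>R_prod t \<sigma> k n = R(\<cdot>) L(t\<^sub>n k) \<cdots> R(1/\<sigma>) L(t\<^sub>1 k) R(\<sigma>)\<close>, with \<open>n + 1\<close> factors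
  \<open>R\<close> that alternate between \<open>R(\<sigma>)\<close> and \<open>R(1/\<sigma>)\<close>, starting with \<open>R(\<sigma>)\<close> on the right.\<close>

primrec R_prod :: "(nat \<Rightarrow> real) \<Rightarrow> complex \<Rightarrow> complex \<Rightarrow> nat \<Rightarrow> complex^2^2" where
  "R_prod t \<sigma> k 0 = R_mat \<sigma>"
| "R_prod t \<sigma> k (Suc n) =
     R_mat (if even (Suc n) then \<sigma> else 1 / \<sigma>) ** L_mat (of_real (t (Suc n)) * k) ** R_prod t \<sigma> k n"

definition M_tot :: "nat \<Rightarrow> (nat \<Rightarrow> real) \<Rightarrow> complex \<Rightarrow> complex \<Rightarrow> complex^2^2" where
  "M_tot N t k \<sigma> =
     (\<chi> a b. (4 * \<sigma>) ^ N / (1 + \<sigma>) ^ (2 * N) * R_prod t \<sigma> k (2 * N - 1) $ a $ b)"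

definition char_fun :: "nat \<Rightarrow> (nat \<Rightarrow> real) \<Rightarrow> complex \<Rightarrow> complex \<Rightarrow> complex" where
  "char_fun N t k \<sigma> = M_tot N t k \<sigma> $ 2 $ 2"

definition eps :: "int \<Rightarrow> int \<Rightarrow> nat" where
  "eps a b = (if a \<noteq> b then 1 else 0)"

text \<open>Extension of \<open>(\<alpha>\<^sub>1, \<dots>, \<alpha>\<^bsub>2N-1\<^esub>)\<close> by \<open>\<alpha>\<^sub>0 = \<alpha>\<^bsub>2N\<^esub> = -1\<close>.\<close>

definition sign_ext :: "nat \<Rightarrow> (nat \<Rightarrow> int) \<Rightarrow> nat \<Rightarrow> int" where
  "sign_ext N \<alpha> j = (if j = 0 \<or> j = 2 * N then - 1 else \<alpha> j)"

end

theory Submission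
  imports Defs
begin

text \<open>The \<open>2N\<close> endpoints of the resonators, numbered from left to right, cut the line into \<open>2N + 1\<close>
layers, on each of which the equation has constant coefficients. There every solution is a
combination of a right-going wave \<open>exp (\<i>\<kappa>x)\<close> and a left-going wave \<open>exp (- \<i>\<kappa>x)\<close>
(\<open>helmholtz_on_iff_wave\<close>), so a solution of the whole problem is a sequence of amplitude pairs, one
for each layer. Taking the left endpoint of a layer as the origin of its phases, \<open>L\<close> moves an
amplitude pair across the layer. At an endpoint the sum of the two amplitudes is the value of \<open>u\<close>,
and their difference is \<open>u'\<close> up to the factor \<open>\<i>\<kappa>\<close>; continuity of \<open>u\<close> and the jump of \<open>u'\<close> keep the
sum and multiply the difference by \<open>\<sigma>\<close> or \<open>1/\<sigma>\<close>, which is what \<open>R(\<sigma>)\<close> and \<open>R(1/\<sigma>)\<close> do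
(\<open>R_mat_vector_iff\<close>, \<open>transmission_iff\<close>). Hence the amplitudes on the far right are the matrix
product applied to those on the far left. The radiation conditions say that nothing comes in: the
first amplitude vanishes on the far left and the second on the far right. A solution that satisfies
the left condition is therefore determined by its second amplitude there, and it satisfies the
right condition with this amplitude nonzero exactly if the lower right entry of the product is
zero (\<open>resonant_frequency_iff_entry\<close>).

The sum formula is the expansion of that entry over paths of indices, the index \<open>1\<close> being coded by the sign
\<open>1\<close> and the index \<open>2\<close> by \<open>-1\<close> (\<open>R_prod_path_sum\<close>). After the normalising prefactor has cancelled the diagonal
entries of the \<open>R\<close>, each change of sign costs a factor \<open>\<rho> = (1 - \<sigma>) / (1 + \<sigma>)\<close> at \<open>R(\<sigma>)\<close> and \<open>-\<rho>\<close>
at \<open>R(1/\<sigma>)\<close>. A path runs from \<open>-1\<close> to \<open>-1\<close> and so changes sign an even number of times; this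
makes the parity of the changes at the even-numbered factors equal to that at the odd-numbered
ones. Analyticity is read off from the finite exponential sum.\<close>

section \<open>The characteristic function as a sum over sign sequences\<close>

definition sign_index :: "int \<Rightarrow> 2" where
  "sign_index a = (if a = 1 then 1 else 2)"

definition R_step :: "complex \<Rightarrow> nat \<Rightarrow> complex^2^2" where
  "R_step \<sigma> n = R_mat (if even n then \<sigma> else 1 / \<sigma>)"

lemma R_prod_Suc:
  "R_prod t \<sigma> z (Suc n) = R_step \<sigma> (Suc n) ** L_mat (of_real (t (Suc n)) * z) ** R_prod t \<sigma> z n"
  by (simp add: R_step_def)

lemma R_prod_0: "R_prod t \<sigma> z 0 = R_step \<sigma> 0"
  by (simp add: R_step_def)

lemma R_prod_Suc_entry:
  "R_prod t \<sigma> z (Suc n) $ i $ j =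
     (\<Sum>c\<in>{-1, 1}. R_step \<sigma> (Suc n) $ i $ sign_index c *
        exp (\<i> * of_real (of_int c * t (Suc n)) * z) * R_prod t \<sigma> z n $ sign_index c $ j)"
  unfolding R_prod_Suc
  by (simp add: matrix_matrix_mult_def sum_2 L_mat_def vector_2 sign_index_def algebra_simps)

lemma sum_PiE_insert:
  assumes "x \<notin> S" "finite S" "\<And>i. i \<in> insert x S \<Longrightarrow> finite (T i)"
  shows "(\<Sum>\<alpha>\<in>Pi\<^sub>E (insert x S) T. F \<alpha>) = (\<Sum>c\<in>T x. \<Sum>\<beta>\<in>Pi\<^sub>E S T. F (\<beta>(x := c)))"
proof -
  have "(\<Sum>\<alpha>\<in>Pi\<^sub>E (insert x S) T. F \<alpha>) = (\<Sum>(c, \<beta>)\<in>T x \<times> Pi\<^sub>E S T. F (\<beta>(x := c)))"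
    unfolding PiE_insert_eq
    by (subst sum.reindex[OF inj_combinator[OF assms(1)]]) (simp add: case_prod_unfold o_def)
  then show ?thesis
    by (simp add: sum.cartesian_product)
qed

text \<open>The general entry \<open>a\<close> of the second column is needed for the induction on \<open>n\<close>, in which the value of
\<open>\<alpha>\<close> at \<open>n + 1\<close> becomes the end point of the shorter path.\<close>

lemma R_prod_path_sum:
  "R_prod t \<sigma> z n $ sign_index a $ 2 =
     (\<Sum>\<alpha>\<in>{1..n} \<rightarrow>\<^sub>E {-1, 1}. let p = \<alpha>(0 := -1, Suc n := a) in
        (\<Prod>j<Suc n. R_step \<sigma> j $ sign_index (p (Suc j)) $ sign_index (p j)) *
        exp (\<i> * of_real (\<Sum>j=1..n. of_int (\<alpha> j) * t j) * z))"
proof (induction n arbitrary: a)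
  case 0
  show ?case by (simp add: R_prod_0 sign_index_def Let_def del: R_prod.simps)
next
  case (Suc n)
  define W where "W j p = R_step \<sigma> j $ sign_index (p (Suc j)) $ sign_index (p j)" for j p
  have split_last: "(\<Sum>\<alpha>\<in>{1..Suc n} \<rightarrow>\<^sub>E {-1, 1}. F \<alpha>) =
      (\<Sum>c\<in>{-1, 1}. \<Sum>\<beta>\<in>{1..n} \<rightarrow>\<^sub>E {-1, 1}. F (\<beta>(Suc n := c)))"
    for F :: "(nat \<Rightarrow> int) \<Rightarrow> complex"
  proof -
    have "{1..Suc n} = insert (Suc n) {1..n}" by auto
    then show ?thesis by (simp only:) (subst sum_PiE_insert, auto)
  qed
  have "(\<Sum>\<alpha>\<in>{1..Suc n} \<rightarrow>\<^sub>E {-1, 1}. (\<Prod>j<Suc (Suc n). W j (\<alpha>(0 := -1, Suc (Suc n) := a))) *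
        exp (\<i> * of_real (\<Sum>j=1..Suc n. of_int (\<alpha> j) * t j) * z)) =
      (\<Sum>c\<in>{-1, 1}. \<Sum>\<beta>\<in>{1..n} \<rightarrow>\<^sub>E {-1, 1}.
        (\<Prod>j<Suc (Suc n). W j ((\<beta>(Suc n := c))(0 := -1, Suc (Suc n) := a))) *
        exp (\<i> * of_real (\<Sum>j=1..Suc n. of_int ((\<beta>(Suc n := c)) j) * t j) * z))"
    by (rule split_last)
  also have "\<dots> = (\<Sum>c\<in>{-1, 1}. \<Sum>\<beta>\<in>{1..n} \<rightarrow>\<^sub>E {-1, 1}.
        R_step \<sigma> (Suc n) $ sign_index a $ sign_index c *
        exp (\<i> * of_real (of_int c * t (Suc n)) * z) *
        ((\<Prod>j<Suc n. W j (\<beta>(0 := -1, Suc n := c))) *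
         exp (\<i> * of_real (\<Sum>j=1..n. of_int (\<beta> j) * t j) * z)))"
  proof (intro sum.cong refl)
    fix c :: int and \<beta> :: "nat \<Rightarrow> int"
    have "(\<Prod>j<Suc n. W j ((\<beta>(Suc n := c))(0 := -1, Suc (Suc n) := a))) =
        (\<Prod>j<Suc n. W j (\<beta>(0 := -1, Suc n := c)))"
      by (intro prod.cong) (auto simp: W_def)
    moreover have "W (Suc n) ((\<beta>(Suc n := c))(0 := -1, Suc (Suc n) := a)) =
        R_step \<sigma> (Suc n) $ sign_index a $ sign_index c"
      by (simp add: W_def)
    moreover have "(\<Sum>j=1..Suc n. of_int ((\<beta>(Suc n := c)) j) * t j) =
        of_int c * t (Suc n) + (\<Sum>j=1..n. of_int (\<beta> j) * t j)"
    proof -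
      have "(\<Sum>j=1..n. of_int ((\<beta>(Suc n := c)) j) * t j) = (\<Sum>j=1..n. of_int (\<beta> j) * t j)"
        by (intro sum.cong) auto
      then show ?thesis by simp
    qed
    ultimately show "(\<Prod>j<Suc (Suc n). W j ((\<beta>(Suc n := c))(0 := -1, Suc (Suc n) := a))) *
        exp (\<i> * of_real (\<Sum>j=1..Suc n. of_int ((\<beta>(Suc n := c)) j) * t j) * z) =
        R_step \<sigma> (Suc n) $ sign_index a $ sign_index c *
        exp (\<i> * of_real (of_int c * t (Suc n)) * z) *
        ((\<Prod>j<Suc n. W j (\<beta>(0 := -1, Suc n := c))) *
         exp (\<i> * of_real (\<Sum>j=1..n. of_int (\<beta> j) * t j) * z))"
      by (simp only: prod.lessThan_Suc[of _ "Suc n"] of_real_add distrib_left distrib_right exp_add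
          mult.assoc mult.commute mult.left_commute)
  qed
  also have "\<dots> = R_prod t \<sigma> z (Suc n) $ sign_index a $ 2"
    unfolding R_prod_Suc_entry Suc.IH
    by (simp only: Let_def W_def sum_distrib_left)
  finally show ?case
    unfolding W_def Let_def by (rule sym)
qed

lemma even_sum_eps_iff:
  assumes "\<And>j. j \<le> n \<Longrightarrow> p j \<in> {-1, 1}"
  shows "even (\<Sum>j<n. eps (p (Suc j)) (p j)) \<longleftrightarrow> p n = p 0"
  using assms
proof (induction n)
  case (Suc n)
  have ends: "p 0 \<in> {-1, 1}" "p n \<in> {-1, 1}" "p (Suc n) \<in> {-1, 1}"
    using Suc.prems by simp_all
  have "even (\<Sum>j<n. eps (p (Suc j)) (p j)) \<longleftrightarrow> p n = p 0"
    using Suc by simp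
  with ends show ?case by (auto simp: eps_def)
qed simp

text \<open>The exponent of \<open>-1\<close> contains \<open>n\<close> because \<open>(1 - 1/\<sigma>) / (1 + 1/\<sigma>) = - (1 - \<sigma>) / (1 + \<sigma>)\<close>.\<close>

lemma R_step_entry:
  assumes "\<sigma> \<noteq> 0" "1 + \<sigma> \<noteq> 0" "a \<in> {-1, 1}" "b \<in> {-1, 1}"
  shows "R_step \<sigma> n $ sign_index a $ sign_index b =
    (if even n then (1 + \<sigma>) / 2 else (1 + \<sigma>) / (2 * \<sigma>)) *
    ((-1) ^ (n * eps a b) * ((1 - \<sigma>) / (1 + \<sigma>)) ^ eps a b)"
  using assms by (auto simp: R_step_def R_mat_def sign_index_def eps_def vector_2 field_simps)

lemma prod_normalisation:
  fixes \<sigma> :: complex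
  shows "(\<Prod>j<2 * N. if even j then (1 + \<sigma>) / 2 else (1 + \<sigma>) / (2 * \<sigma>)) =
    (1 + \<sigma>) ^ (2 * N) / (4 * \<sigma>) ^ N"
  by (induction N) (simp_all add: field_simps)

text \<open>The factors \<open>R\<close> are numbered from \<open>0\<close> in \<open>R_step\<close> but from \<open>1\<close> in the exponent of \<open>-1\<close>. The shift adds
the number of sign changes of the path to that exponent, and this number is even.\<close>

lemma char_fun_path_sum:
  assumes N: "N \<ge> 1" and \<sigma>: "\<sigma> \<noteq> 0" "1 + \<sigma> \<noteq> 0"
  shows "char_fun N t z \<sigma> =
      (\<Sum>\<alpha>\<in>{1..2 * N - 1} \<rightarrow>\<^sub>E {- 1, 1 :: int}.
         (- 1) ^ (\<Sum>j=1..2 * N. j * eps (sign_ext N \<alpha> j) (sign_ext N \<alpha> (j - 1))) *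
         ((1 - \<sigma>) / (1 + \<sigma>)) ^ (\<Sum>j=1..2 * N. eps (sign_ext N \<alpha> j) (sign_ext N \<alpha> (j - 1))) *
         exp (\<i> * of_real (\<Sum>j=1..2 * N - 1. of_int (\<alpha> j) * t j) * z))"
proof -
  define \<rho> where "\<rho> = (1 - \<sigma>) / (1 + \<sigma>)"
  have Suc_pred: "Suc (2 * N - 1) = 2 * N" using N by simp
  have shift: "(\<Sum>j=1..2 * N. h j) = (\<Sum>j<2 * N. h (Suc j))" for h :: "nat \<Rightarrow> nat"
    using sum.atLeast1_atMost_eq[of h "2 * N"] by simp
  have weight: "(4 * \<sigma>) ^ N / (1 + \<sigma>) ^ (2 * N) *
      (\<Prod>j<2 * N. R_step \<sigma> j $ sign_index (p (Suc j)) $ sign_index (p j)) =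
      (-1) ^ (\<Sum>j=1..2 * N. j * eps (p j) (p (j - 1))) * \<rho> ^ (\<Sum>j=1..2 * N. eps (p j) (p (j - 1)))"
    if p: "\<And>j. j \<le> 2 * N \<Longrightarrow> p j \<in> {-1, 1}" and ends: "p 0 = -1" "p (2 * N) = -1" for p
  proof -
    define e where "e j = eps (p (Suc j)) (p j)" for j
    have "(\<Prod>j<2 * N. R_step \<sigma> j $ sign_index (p (Suc j)) $ sign_index (p j)) =
        (\<Prod>j<2 * N. (if even j then (1 + \<sigma>) / 2 else (1 + \<sigma>) / (2 * \<sigma>)) *
          ((-1) ^ (j * e j) * \<rho> ^ e j))"
      unfolding e_def \<rho>_def
      by (intro prod.cong refl R_step_entry[OF \<sigma>] p) auto
    also have "\<dots> = (1 + \<sigma>) ^ (2 * N) / (4 * \<sigma>) ^ N *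
        ((-1) ^ (\<Sum>j<2 * N. j * e j) * \<rho> ^ (\<Sum>j<2 * N. e j))"
      by (simp only: prod.distrib prod_normalisation power_sum)
    finally have "(4 * \<sigma>) ^ N / (1 + \<sigma>) ^ (2 * N) *
      (\<Prod>j<2 * N. R_step \<sigma> j $ sign_index (p (Suc j)) $ sign_index (p j)) =
        (-1) ^ (\<Sum>j<2 * N. j * e j) * \<rho> ^ (\<Sum>j<2 * N. e j)"
      using \<sigma> by simp
    also have "(-1 :: complex) ^ (\<Sum>j<2 * N. j * e j) = (-1) ^ (\<Sum>j<2 * N. Suc j * e j)"
    proof -
      have "even (\<Sum>j<2 * N. e j)"
        unfolding e_def using even_sum_eps_iff[of "2 * N" p] p ends by simp
      moreover have "(\<Sum>j<2 * N. Suc j * e j) = (\<Sum>j<2 * N. e j) + (\<Sum>j<2 * N. j * e j)"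
        by (simp add: sum.distrib)
      ultimately show ?thesis
        by (simp only: power_add) simp
    qed
    finally show ?thesis
      unfolding shift e_def diff_Suc_1 .
  qed
  have "char_fun N t z \<sigma> = (4 * \<sigma>) ^ N / (1 + \<sigma>) ^ (2 * N) *
      R_prod t \<sigma> z (2 * N - 1) $ sign_index (-1) $ 2"
    by (simp add: char_fun_def M_tot_def sign_index_def)
  also have "\<dots> = (\<Sum>\<alpha>\<in>{1..2 * N - 1} \<rightarrow>\<^sub>E {- 1, 1 :: int}. (4 * \<sigma>) ^ N / (1 + \<sigma>) ^ (2 * N) *
      (\<Prod>j<2 * N. R_step \<sigma> j $ sign_index (sign_ext N \<alpha> (Suc j)) $ sign_index (sign_ext N \<alpha> j)) *
      exp (\<i> * of_real (\<Sum>j=1..2 * N - 1. of_int (\<alpha> j) * t j) * z))"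
  proof -
    have "\<alpha>(0 := -1, 2 * N := -1) = sign_ext N \<alpha>" for \<alpha>
      by (auto simp: sign_ext_def)
    then show ?thesis
      unfolding R_prod_path_sum Let_def Suc_pred by (simp only: sum_distrib_left mult.assoc)
  qed
  also have "\<dots> = (\<Sum>\<alpha>\<in>{1..2 * N - 1} \<rightarrow>\<^sub>E {- 1, 1 :: int}.
         (- 1) ^ (\<Sum>j=1..2 * N. j * eps (sign_ext N \<alpha> j) (sign_ext N \<alpha> (j - 1))) *
         \<rho> ^ (\<Sum>j=1..2 * N. eps (sign_ext N \<alpha> j) (sign_ext N \<alpha> (j - 1))) *
         exp (\<i> * of_real (\<Sum>j=1..2 * N - 1. of_int (\<alpha> j) * t j) * z))"
  proof (intro sum.cong refl)
    fix \<alpha> :: "nat \<Rightarrow> int"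
    assume \<alpha>: "\<alpha> \<in> {1..2 * N - 1} \<rightarrow>\<^sub>E {- 1, 1}"
    have signs: "sign_ext N \<alpha> j \<in> {-1, 1}" if j: "j \<le> 2 * N" for j
    proof (cases "j = 0 \<or> j = 2 * N")
      case False
      with j have "j \<in> {1..2 * N - 1}" by auto
      with \<alpha> have "\<alpha> j \<in> {-1, 1}" by (rule PiE_mem)
      with False show ?thesis by (simp add: sign_ext_def)
    qed (auto simp: sign_ext_def)
    have ends: "sign_ext N \<alpha> 0 = -1" "sign_ext N \<alpha> (2 * N) = -1"
      by (simp_all add: sign_ext_def)
    show "(4 * \<sigma>) ^ N / (1 + \<sigma>) ^ (2 * N) *
      (\<Prod>j<2 * N. R_step \<sigma> j $ sign_index (sign_ext N \<alpha> (Suc j)) $ sign_index (sign_ext N \<alpha> j)) *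
      exp (\<i> * of_real (\<Sum>j=1..2 * N - 1. of_int (\<alpha> j) * t j) * z) =
         (- 1) ^ (\<Sum>j=1..2 * N. j * eps (sign_ext N \<alpha> j) (sign_ext N \<alpha> (j - 1))) *
         \<rho> ^ (\<Sum>j=1..2 * N. eps (sign_ext N \<alpha> j) (sign_ext N \<alpha> (j - 1))) *
         exp (\<i> * of_real (\<Sum>j=1..2 * N - 1. of_int (\<alpha> j) * t j) * z)"
      by (simp only: weight[OF signs ends])
  qed
  finally show ?thesis unfolding \<rho>_def .
qed

lemma char_fun_analytic:
  assumes "N \<ge> 1" "\<sigma> \<noteq> 0" "1 + \<sigma> \<noteq> 0"
  shows "(\<lambda>z. char_fun N t z \<sigma>) analytic_on UNIV"
  unfolding char_fun_path_sum[OF assms] by (intro analytic_intros)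

section \<open>Plane waves and the Helmholtz equation\<close>

definition wave :: "complex \<Rightarrow> complex^2 \<Rightarrow> real \<Rightarrow> complex" where
  "wave \<kappa> c x = c $ 1 * exp (\<i> * \<kappa> * of_real x) + c $ 2 * exp (- \<i> * \<kappa> * of_real x)"

text \<open>Amplitudes of the derivative of a wave, which is again a wave of the same wavenumber.\<close>

definition deriv_coeffs :: "complex \<Rightarrow> complex^2 \<Rightarrow> complex^2" where
  "deriv_coeffs \<kappa> c = vector [\<i> * \<kappa> * c $ 1, - \<i> * \<kappa> * c $ 2]"

lemma wave_has_vector_derivative:
  "((\<lambda>x. wave \<kappa> c (x - p)) has_vector_derivative wave \<kappa> (deriv_coeffs \<kappa> c) (x - p)) (at x)"
proof -
  have "((\<lambda>z. c $ 1 * exp (\<i> * \<kappa> * (z - of_real p)) + c $ 2 * exp (- \<i> * \<kappa> * (z - of_real p)))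
      has_field_derivative wave \<kappa> (deriv_coeffs \<kappa> c) (x - p)) (at (of_real x))"
    unfolding wave_def deriv_coeffs_def vector_2
    by (rule derivative_eq_intros refl | simp)+
  from has_vector_derivative_real_field[OF this] show ?thesis
    by (simp add: wave_def)
qed

lemma wave_deriv_coeffs_twice: "wave \<kappa> (deriv_coeffs \<kappa> (deriv_coeffs \<kappa> c)) x = - \<kappa>\<^sup>2 * wave \<kappa> c x"
  by (simp add: wave_def deriv_coeffs_def vector_2 algebra_simps power2_eq_square)

lemma wave_tendsto: "((\<lambda>x. wave \<kappa> c (x - p)) \<longlongrightarrow> wave \<kappa> c (x - p)) (at x within S)"
  unfolding wave_def by (intro tendsto_intros)

lemma vderiv_eq_wave:
  assumes "open S" "\<And>x. x \<in> S \<Longrightarrow> u x = wave \<kappa> c (x - p)" "x \<in> S"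
  shows "(u has_vector_derivative wave \<kappa> (deriv_coeffs \<kappa> c) (x - p)) (at x)"
    and "vderiv u x = wave \<kappa> (deriv_coeffs \<kappa> c) (x - p)"
proof -
  show "(u has_vector_derivative wave \<kappa> (deriv_coeffs \<kappa> c) (x - p)) (at x)"
    by (rule has_vector_derivative_transform_within_open[OF wave_has_vector_derivative assms(1,3)])
      (simp add: assms(2))
  then show "vderiv u x = wave \<kappa> (deriv_coeffs \<kappa> c) (x - p)"
    by (rule vector_derivative_at)
qed

lemma exp_linear_has_vector_derivative:
  "((\<lambda>x. exp (a * of_real (x - p))) has_vector_derivative a * exp (a * of_real (x - p))) (at x)"
  for a :: complex
proof -
  have "((\<lambda>z. exp (a * (z - of_real p))) has_field_derivative a * exp (a * of_real (x - p)))
      (at (of_real x))"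
    by (rule derivative_eq_intros refl | simp)+
  from has_vector_derivative_real_field[OF this] show ?thesis by simp
qed

text \<open>The two roots of \<open>s\<^sup>2 = - \<kappa>\<^sup>2\<close> factor the operator, as
\<open>u'' + \<kappa>\<^sup>2 u = (d/dx - s) (u' + s u)\<close>. So \<open>(u' + s u) exp (- s x)\<close> is constant for both roots, and
\<open>u\<close> is recovered from the two constants because \<open>\<kappa> \<noteq> 0\<close> makes the roots distinct.\<close>

lemma helmholtz_on_iff_wave:
  assumes S: "open S" "convex S" and \<kappa>: "\<kappa> \<noteq> 0"
  shows "helmholtz_on \<kappa> S u \<longleftrightarrow> (\<exists>c. \<forall>x\<in>S. u x = wave \<kappa> c (x - p))"
proof
  assume u: "helmholtz_on \<kappa> S u"
  define g where "g s x = (vderiv u x + s * u x) * exp (- s * of_real (x - p))" for s x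
  have g_const: "\<exists>C. \<forall>x\<in>S. g s x = C" if s: "s\<^sup>2 = - \<kappa>\<^sup>2" for s
  proof -
    have "(g s has_vector_derivative 0) (at x within S)" if "x \<in> S" for x
    proof -
      have d: "(u has_vector_derivative vderiv u x) (at x)"
        "(vderiv u has_vector_derivative vderiv (vderiv u) x) (at x)"
        and eq: "vderiv (vderiv u) x = - \<kappa>\<^sup>2 * u x"
        using u \<open>x \<in> S\<close> by (auto simp: helmholtz_on_def vector_derivative_works eq_neg_iff_add_eq_0)
      have "(g s has_vector_derivative
          (vderiv u x + s * u x) * (- s * exp (- s * of_real (x - p))) +
          (vderiv (vderiv u) x + s * vderiv u x) * exp (- s * of_real (x - p))) (at x)"
        unfolding g_def
        by (intro has_vector_derivative_mult has_vector_derivative_add d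
            has_vector_derivative_mult_right exp_linear_has_vector_derivative)
      also have "(vderiv u x + s * u x) * (- s * exp (- s * of_real (x - p))) +
          (vderiv (vderiv u) x + s * vderiv u x) * exp (- s * of_real (x - p)) =
          (- \<kappa>\<^sup>2 - s\<^sup>2) * u x * exp (- s * of_real (x - p))"
        unfolding eq by (simp add: algebra_simps power2_eq_square)
      finally show ?thesis
        using s by (auto intro: has_vector_derivative_at_within)
    qed
    from has_vector_derivative_zero_constant[OF S(2) this] show ?thesis by metis
  qed
  obtain A where A: "\<And>x. x \<in> S \<Longrightarrow> g (\<i> * \<kappa>) x = A"
    using g_const[of "\<i> * \<kappa>"] by (auto simp: power_mult_distrib)
  obtain B where B: "\<And>x. x \<in> S \<Longrightarrow> g (- \<i> * \<kappa>) x = B"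
    using g_const[of "- \<i> * \<kappa>"] by (auto simp: power_mult_distrib)
  show "\<exists>c. \<forall>x\<in>S. u x = wave \<kappa> c (x - p)"
  proof (intro exI ballI)
    fix x assume "x \<in> S"
    define E where "E = exp (\<i> * \<kappa> * of_real (x - p))"
    have E: "E \<noteq> 0" "exp (- \<i> * \<kappa> * of_real (x - p)) = inverse E"
      by (simp_all add: E_def exp_minus)
    have "(vderiv u x + \<i> * \<kappa> * u x) * inverse E = A"
      using A[OF \<open>x \<in> S\<close>] E(2) by (simp add: g_def)
    then have A': "A * E = vderiv u x + \<i> * \<kappa> * u x"
      using E(1) by (simp add: field_simps)
    have "(vderiv u x - \<i> * \<kappa> * u x) * E = B"
      using B[OF \<open>x \<in> S\<close>] by (simp add: g_def E_def)
    then have B': "B * inverse E = vderiv u x - \<i> * \<kappa> * u x"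
      using E(1) by (simp add: field_simps)
    have "wave \<kappa> (vector [A / (2 * \<i> * \<kappa>), - B / (2 * \<i> * \<kappa>)]) (x - p) =
        (A * E - B * inverse E) / (2 * \<i> * \<kappa>)"
      unfolding wave_def vector_2 E(2) E_def[symmetric] by (simp add: diff_divide_distrib)
    also have "\<dots> = u x"
      unfolding A' B' using \<kappa> by simp
    finally show "u x = wave \<kappa> (vector [A / (2 * \<i> * \<kappa>), - B / (2 * \<i> * \<kappa>)]) (x - p)" ..
  qed
next
  assume "\<exists>c. \<forall>x\<in>S. u x = wave \<kappa> c (x - p)"
  then obtain c where c: "\<And>x. x \<in> S \<Longrightarrow> u x = wave \<kappa> c (x - p)" by blast
  note d1 = vderiv_eq_wave[where u = u, OF S(1) c]
  note d2 = vderiv_eq_wave[where u = "vderiv u", OF S(1) d1(2)]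
  show "helmholtz_on \<kappa> S u"
    unfolding helmholtz_on_def
    using d1(1) d2 c by (auto simp: wave_deriv_coeffs_twice intro: differentiableI_vector)
qed

text \<open>\<open>R(z)\<close> has the eigenvectors \<open>(1, 1)\<close> and \<open>(1, -1)\<close> with eigenvalues \<open>1\<close> and \<open>z\<close>. The coordinates
in this basis are, up to scaling, the value and the derivative of a wave.\<close>

lemma R_mat_vector_iff:
  "c = R_mat z *v d \<longleftrightarrow> c $ 1 + c $ 2 = d $ 1 + d $ 2 \<and> c $ 1 - c $ 2 = z * (d $ 1 - d $ 2)"
proof -
  define p q where "p = (d $ 1 + d $ 2) / 2" and "q = z * (d $ 1 - d $ 2) / 2"
  have "(R_mat z *v d) $ 1 = p + q" "(R_mat z *v d) $ 2 = p - q"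
    unfolding p_def q_def
    by (simp_all add: matrix_vector_mult_def sum_2 R_mat_def vector_2 field_simps)
  then have "c = R_mat z *v d \<longleftrightarrow> c $ 1 = p + q \<and> c $ 2 = p - q"
    by (simp add: vec_eq_iff forall_2)
  also have "\<dots> \<longleftrightarrow> c $ 1 + c $ 2 = 2 * p \<and> c $ 1 - c $ 2 = 2 * q"
  proof
    assume *: "c $ 1 + c $ 2 = 2 * p \<and> c $ 1 - c $ 2 = 2 * q"
    have "2 * c $ 1 = (c $ 1 + c $ 2) + (c $ 1 - c $ 2)" "2 * c $ 2 = (c $ 1 + c $ 2) - (c $ 1 - c $ 2)"
      by simp_all
    then have "2 * c $ 1 = 2 * (p + q)" "2 * c $ 2 = 2 * (p - q)"
      using * by (simp_all add: distrib_left right_diff_distrib)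
    then show "c $ 1 = p + q \<and> c $ 2 = p - q" unfolding mult_cancel_left by simp
  qed simp
  also have "2 * p = d $ 1 + d $ 2" by (simp add: p_def)
  also have "2 * q = z * (d $ 1 - d $ 2)" by (simp add: q_def)
  finally show ?thesis .
qed

lemma wave_eq_L_mat:
  fixes x :: real and \<kappa> :: complex and c :: "complex^2"
  defines "d \<equiv> L_mat (\<kappa> * of_real x) *v c"
  shows "wave \<kappa> c x = d $ 1 + d $ 2" "wave \<kappa> (deriv_coeffs \<kappa> c) x = \<i> * \<kappa> * (d $ 1 - d $ 2)"
  by (simp_all add: d_def wave_def deriv_coeffs_def L_mat_def matrix_vector_mult_def sum_2 vector_2
      algebra_simps)

lemma L_mat_0: "L_mat 0 = mat 1"
  by (simp add: L_mat_def mat_def vec_eq_iff forall_2 vector_2)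

text \<open>The operators \<open>- d/dx - \<i>\<kappa>\<close> and \<open>d/dx - \<i>\<kappa>\<close> each annihilate one of the two waves and multiply the other
by \<open>- 2 \<i>\<kappa>\<close>.\<close>

lemma wave_radiation:
  assumes "\<kappa> \<noteq> 0"
  shows "- wave \<kappa> (deriv_coeffs \<kappa> c) s - \<i> * \<kappa> * wave \<kappa> c s = 0 \<longleftrightarrow> c $ 1 = 0"
    and "wave \<kappa> (deriv_coeffs \<kappa> c) s - \<i> * \<kappa> * wave \<kappa> c s = 0 \<longleftrightarrow> c $ 2 = 0"
proof -
  have "- wave \<kappa> (deriv_coeffs \<kappa> c) s - \<i> * \<kappa> * wave \<kappa> c s = - 2 * \<i> * \<kappa> * c $ 1 * exp (\<i> * \<kappa> * of_real s)"
    "wave \<kappa> (deriv_coeffs \<kappa> c) s - \<i> * \<kappa> * wave \<kappa> c s = - 2 * \<i> * \<kappa> * c $ 2 * exp (- \<i> * \<kappa> * of_real s)"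
    by (simp_all add: wave_def deriv_coeffs_def vector_2 algebra_simps)
  then show "- wave \<kappa> (deriv_coeffs \<kappa> c) s - \<i> * \<kappa> * wave \<kappa> c s = 0 \<longleftrightarrow> c $ 1 = 0"
    "wave \<kappa> (deriv_coeffs \<kappa> c) s - \<i> * \<kappa> * wave \<kappa> c s = 0 \<longleftrightarrow> c $ 2 = 0"
    using assms by simp_all
qed

section \<open>Layers cut out by finitely many interfaces\<close>

text \<open>The component number \<open>m\<close>, counted from \<open>0\<close>, of the real line without the points
\<open>y 0 < \<dots> < y (K - 1)\<close>. The components \<open>0\<close> and \<open>K\<close> are half-lines.\<close>

definition layer :: "nat \<Rightarrow> (nat \<Rightarrow> real) \<Rightarrow> nat \<Rightarrow> real set" where
  "layer K y m = {x. (0 < m \<longrightarrow> y (m - 1) < x) \<and> (m < K \<longrightarrow> x < y m)}"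

lemma layer_eq:
  "layer K y m = (if 0 < m then {y (m - 1)<..} else UNIV) \<inter> (if m < K then {..<y m} else UNIV)"
  by (auto simp: layer_def)

lemma open_layer: "open (layer K y m)"
  unfolding layer_eq by (intro open_Int) auto

lemma convex_layer: "convex (layer K y m)"
  unfolding layer_eq by (intro convex_Int) auto

text \<open>The layer of \<open>x\<close> ends at the first interface that lies to the right of \<open>x\<close>.\<close>

lemma layer_exhaust:
  assumes "\<And>n. n < K \<Longrightarrow> x \<noteq> y n"
  obtains m where "m \<le> K" "x \<in> layer K y m"
proof
  define m where "m = (LEAST m. m = K \<or> x < y m)"
  have m: "m = K \<or> x < y m" unfolding m_def by (rule LeastI_ex) blast
  show le: "m \<le> K" unfolding m_def by (rule Least_le) simp
  have "y (m - 1) < x" if "0 < m"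
  proof -
    have "\<not> (m - 1 = K \<or> x < y (m - 1))"
      using not_less_Least[of "m - 1" "\<lambda>m. m = K \<or> x < y m"] that by (simp add: m_def)
    then show ?thesis using assms[of "m - 1"] le that by fastforce
  qed
  with m show "x \<in> layer K y m" by (auto simp: layer_def)
qed

locale layers =
  fixes K :: nat and y :: "nat \<Rightarrow> real"
  assumes Suc_less: "Suc n < K \<Longrightarrow> y n < y (Suc n)"
begin

lemma interface_less: "m < n \<Longrightarrow> n < K \<Longrightarrow> y m < y n"
proof (induction n rule: less_induct)
  case (less n)
  then obtain n' where "n = Suc n'" by (cases n) auto
  with less Suc_less[of n'] show ?case by (cases "m = n'") force+
qed

lemma layer_interfaces:
  assumes "x \<in> layer K y m" "m \<le> K"
  shows "{n. n < K \<and> y n < x} = {..<m}" "n < K \<Longrightarrow> x \<noteq> y n"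
proof -
  have 1: "y n < x" if "n < m" for n
  proof (cases "n = m - 1")
    case False
    then have "y n < y (m - 1)" using that assms(2) by (intro interface_less) auto
    then show ?thesis using assms that by (auto simp: layer_def)
  qed (use assms that in \<open>auto simp: layer_def\<close>)
  have 2: "x < y n" if "m \<le> n" "n < K" for n
  proof (cases "n = m")
    case False
    then have "y m < y n" using that by (intro interface_less) auto
    then show ?thesis using assms that by (auto simp: layer_def)
  qed (use assms that in \<open>auto simp: layer_def\<close>)
  show "{n. n < K \<and> y n < x} = {..<m}"
    using 1 2 assms(2) by (fastforce simp: not_less[symmetric])
  show "n < K \<Longrightarrow> x \<noteq> y n"
    using 1 2 by (cases "n < m") (force simp: not_less)+
qed

lemma layer_unique:
  assumes "x \<in> layer K y m" "m \<le> K" "x \<in> layer K y m'" "m' \<le> K"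
  shows "m = m'"
  using layer_interfaces(1)[OF assms(1,2)] layer_interfaces(1)[OF assms(3,4)] by simp

lemma eventually_at_left_layer:
  assumes "n < K"
  shows "eventually (\<lambda>x. x \<in> layer K y n) (at_left (y n))"
proof -
  have "eventually (\<lambda>x. x \<in> {(if n = 0 then y 0 - 1 else y (n - 1))<..<y n}) (at_left (y n))"
    using Suc_less[of "n - 1"] assms by (intro eventually_at_left_real) auto
  then show ?thesis by eventually_elim (auto simp: layer_def split: if_splits)
qed

lemma eventually_at_right_layer:
  assumes "n < K"
  shows "eventually (\<lambda>x. x \<in> layer K y (Suc n)) (at_right (y n))"
proof -
  have "eventually (\<lambda>x. x \<in> {y n<..<(if Suc n < K then y (Suc n) else y n + 1)}) (at_right (y n))"
    using Suc_less[of n] assms by (intro eventually_at_right_real) auto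
  then show ?thesis by eventually_elim (auto simp: layer_def split: if_splits)
qed

end

section \<open>Amplitudes of piecewise plane waves\<close>

definition wavenumber :: "real \<Rightarrow> complex \<Rightarrow> nat \<Rightarrow> complex" where
  "wavenumber r k m = (if even m then k else of_real r * k)"

text \<open>The derivative on the side of the resonator is \<open>\<delta>\<close> times the other one. That side is the right side of an interface
with an even number and the left side of one with an odd number.\<close>

definition transmission :: "complex \<Rightarrow> nat \<Rightarrow> real \<Rightarrow> (real \<Rightarrow> complex) \<Rightarrow> bool" where
  "transmission \<delta> n x u \<longleftrightarrow>
     (\<exists>a. (u \<longlongrightarrow> a) (at_right x) \<and> (u \<longlongrightarrow> a) (at_left x)) \<and>
     (\<exists>b. (vderiv u \<longlongrightarrow> (if even n then \<delta> * b else b)) (at_right x) \<and>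
          (vderiv u \<longlongrightarrow> (if even n then b else \<delta> * b)) (at_left x))"

context layers
begin

text \<open>The wave on a layer has its phases centred at the left endpoint of the layer. The layer \<open>0\<close> has none;
there \<open>0 - 1 = 0\<close> on the naturals places the centre at \<open>y 0\<close>, so that its amplitudes reach the first
interface unchanged.\<close>

definition piecewise_wave ::
  "(nat \<Rightarrow> complex) \<Rightarrow> (nat \<Rightarrow> complex^2) \<Rightarrow> (real \<Rightarrow> complex) \<Rightarrow> bool" where
  "piecewise_wave \<kappa> C u \<longleftrightarrow>
     (\<forall>m\<le>K. \<forall>x\<in>layer K y m. u x = wave (\<kappa> m) (C m) (x - y (m - 1)))"

lemma helmholtz_on_layers_iff:
  assumes "\<And>m. m \<le> K \<Longrightarrow> \<kappa> m \<noteq> 0"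
  shows "(\<forall>m\<le>K. helmholtz_on (\<kappa> m) (layer K y m) u) \<longleftrightarrow> (\<exists>C. piecewise_wave \<kappa> C u)"
proof -
  have "(\<forall>m\<le>K. helmholtz_on (\<kappa> m) (layer K y m) u) \<longleftrightarrow>
      (\<forall>m. \<exists>c. m \<le> K \<longrightarrow> (\<forall>x\<in>layer K y m. u x = wave (\<kappa> m) c (x - y (m - 1))))"
    using helmholtz_on_iff_wave[OF open_layer convex_layer assms] by blast
  then show ?thesis unfolding choice_iff piecewise_wave_def .
qed

text \<open>Counting the interfaces to the left of a point gives the number of its layer.\<close>

lemma piecewise_wave_exists: "\<exists>u. piecewise_wave \<kappa> C u"
proof (intro exI)
  define m where "m x = card {n. n < K \<and> y n < x}" for x
  have "m x = i" if "x \<in> layer K y i" "i \<le> K" for x i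
    unfolding m_def layer_interfaces(1)[OF that] by simp
  then show "piecewise_wave \<kappa> C (\<lambda>x. wave (\<kappa> (m x)) (C (m x)) (x - y (m x - 1)))"
    by (simp add: piecewise_wave_def)
qed

lemma vderiv_piecewise_wave:
  assumes "piecewise_wave \<kappa> C u" "m \<le> K" "x \<in> layer K y m"
  shows "vderiv u x = wave (\<kappa> m) (deriv_coeffs (\<kappa> m) (C m)) (x - y (m - 1))"
  by (rule vderiv_eq_wave(2)[OF open_layer _ assms(3)])
    (use assms in \<open>simp add: piecewise_wave_def\<close>)

lemma piecewise_wave_limits:
  assumes u: "piecewise_wave \<kappa> C u" and n: "n < K"
  shows "(u \<longlongrightarrow> wave (\<kappa> n) (C n) (y n - y (n - 1))) (at_left (y n))"
    and "(vderiv u \<longlongrightarrow> wave (\<kappa> n) (deriv_coeffs (\<kappa> n) (C n)) (y n - y (n - 1))) (at_left (y n))"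
    and "(u \<longlongrightarrow> wave (\<kappa> (Suc n)) (C (Suc n)) 0) (at_right (y n))"
    and "(vderiv u \<longlongrightarrow> wave (\<kappa> (Suc n)) (deriv_coeffs (\<kappa> (Suc n)) (C (Suc n))) 0) (at_right (y n))"
proof -
  have u_eq: "u x = wave (\<kappa> m) (C m) (x - y (m - 1))" if "m \<le> K" "x \<in> layer K y m" for m x
    using u that by (simp add: piecewise_wave_def)
  have left: "(f \<longlongrightarrow> wave (\<kappa> n) c (y n - y (n - 1))) (at_left (y n))"
    if "\<And>x. x \<in> layer K y n \<Longrightarrow> f x = wave (\<kappa> n) c (x - y (n - 1))" for f c
    by (rule Lim_transform_eventually[OF wave_tendsto])
      (use eventually_at_left_layer[OF n] in eventually_elim, simp add: that)
  have right: "(f \<longlongrightarrow> wave (\<kappa> (Suc n)) c 0) (at_right (y n))"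
    if "\<And>x. x \<in> layer K y (Suc n) \<Longrightarrow> f x = wave (\<kappa> (Suc n)) c (x - y n)" for f c
  proof -
    have "((\<lambda>x. wave (\<kappa> (Suc n)) c (x - y n)) \<longlongrightarrow> wave (\<kappa> (Suc n)) c 0) (at_right (y n))"
      using wave_tendsto[of "\<kappa> (Suc n)" c "y n" "y n"] by simp
    then show ?thesis
      by (rule Lim_transform_eventually)
        (use eventually_at_right_layer[OF n] in eventually_elim, simp add: that)
  qed
  show "(u \<longlongrightarrow> wave (\<kappa> n) (C n) (y n - y (n - 1))) (at_left (y n))"
    using n by (intro left u_eq) auto
  show "(vderiv u \<longlongrightarrow> wave (\<kappa> n) (deriv_coeffs (\<kappa> n) (C n)) (y n - y (n - 1))) (at_left (y n))"
    using n by (intro left vderiv_piecewise_wave[OF u]) auto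
  show "(u \<longlongrightarrow> wave (\<kappa> (Suc n)) (C (Suc n)) 0) (at_right (y n))"
    using n u_eq[of "Suc n"] by (intro right) auto
  show "(vderiv u \<longlongrightarrow> wave (\<kappa> (Suc n)) (deriv_coeffs (\<kappa> (Suc n)) (C (Suc n))) 0) (at_right (y n))"
    using n vderiv_piecewise_wave[OF u, of "Suc n"] by (intro right) auto
qed

text \<open>The amplitudes on layer \<open>n\<close> are first moved by \<open>L\<close> to its right endpoint. In the condition on \<open>u'\<close> the
wavenumbers of the two sides have the ratio \<open>r\<close>, so the difference of the
amplitudes is multiplied by \<open>\<sigma> = \<delta> / r\<close> on entering a resonator and divided by it on leaving.\<close>

lemma transmission_iff:
  fixes r :: real and k :: complex
  defines "\<kappa> \<equiv> wavenumber r k"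
  assumes u: "piecewise_wave \<kappa> C u" and n: "n < K"
    and nz: "r \<noteq> 0" "k \<noteq> 0" "\<delta> \<noteq> 0"
  shows "transmission \<delta> n (y n) u \<longleftrightarrow>
    C (Suc n) = R_step (\<delta> / of_real r) n *v (L_mat (\<kappa> n * of_real (y n - y (n - 1))) *v C n)"
proof -
  define d where "d = L_mat (\<kappa> n * of_real (y n - y (n - 1))) *v C n"
  define c where "c = C (Suc n)"
  note lim = piecewise_wave_limits[OF u n]
  have lim_iff: "(f \<longlongrightarrow> a) F \<longleftrightarrow> a = b" if "(f \<longlongrightarrow> b) F" "F \<noteq> bot"
    for f :: "real \<Rightarrow> complex" and a b F
    using tendsto_unique[OF that(2,1)] that by blast
  have left: "wave (\<kappa> n) (C n) (y n - y (n - 1)) = d $ 1 + d $ 2"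
    "wave (\<kappa> n) (deriv_coeffs (\<kappa> n) (C n)) (y n - y (n - 1)) = \<i> * \<kappa> n * (d $ 1 - d $ 2)"
    unfolding d_def by (rule wave_eq_L_mat)+
  have right: "wave (\<kappa> (Suc n)) (C (Suc n)) 0 = c $ 1 + c $ 2"
    "wave (\<kappa> (Suc n)) (deriv_coeffs (\<kappa> (Suc n)) (C (Suc n))) 0 = \<i> * \<kappa> (Suc n) * (c $ 1 - c $ 2)"
    using wave_eq_L_mat[of "\<kappa> (Suc n)" "C (Suc n)" 0] by (simp_all add: L_mat_0 c_def)
  have "transmission \<delta> n (y n) u \<longleftrightarrow> c $ 1 + c $ 2 = d $ 1 + d $ 2 \<and>
      (if even n then \<i> * \<kappa> (Suc n) * (c $ 1 - c $ 2) = \<delta> * (\<i> * \<kappa> n * (d $ 1 - d $ 2))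
       else \<i> * \<kappa> n * (d $ 1 - d $ 2) = \<delta> * (\<i> * \<kappa> (Suc n) * (c $ 1 - c $ 2)))"
    unfolding transmission_def lim_iff[OF lim(1) trivial_limit_at_left_real]
      lim_iff[OF lim(2) trivial_limit_at_left_real] lim_iff[OF lim(3) trivial_limit_at_right_real]
      lim_iff[OF lim(4) trivial_limit_at_right_real] left right
    by auto
  also have "\<dots> \<longleftrightarrow> c $ 1 + c $ 2 = d $ 1 + d $ 2 \<and>
      c $ 1 - c $ 2 = (if even n then \<delta> / of_real r else 1 / (\<delta> / of_real r)) * (d $ 1 - d $ 2)"
  proof -
    have "\<i> * (of_real r * k) * a = \<delta> * (\<i> * k * b) \<longleftrightarrow> a = \<delta> / of_real r * b" for a b
    proof -
      have "\<i> * (of_real r * k) * a = \<delta> * (\<i> * k * b) \<longleftrightarrow> (\<i> * k) * (of_real r * a) = (\<i> * k) * (\<delta> * b)"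
        by (simp add: mult_ac)
      also have "\<dots> \<longleftrightarrow> of_real r * a = \<delta> * b" using nz by simp
      finally show ?thesis using nz by (simp add: field_simps)
    qed
    moreover have "a = \<delta> / of_real r * b \<longleftrightarrow> b = 1 / (\<delta> / of_real r) * a" for a b
      using nz by (auto simp: field_simps)
    ultimately show ?thesis
      by (cases "even n") (simp_all add: \<kappa>_def wavenumber_def)
  qed
  also have "\<dots> \<longleftrightarrow> c = R_step (\<delta> / of_real r) n *v d"
    unfolding R_step_def R_mat_vector_iff ..
  finally show ?thesis unfolding c_def d_def .
qed

end

lemma (in layers) outer_layers_nonempty: "y 0 - 1 \<in> layer K y 0" "\<exists>x. x \<in> layer K y K"
proof -
  show "y 0 - 1 \<in> layer K y 0" by (simp add: layer_def)
  have "y (K - 1) + 1 \<in> layer K y K" by (simp add: layer_def)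
  then show "\<exists>x. x \<in> layer K y K" ..
qed

lemma (in layers) radiation_iff:
  assumes u: "piecewise_wave \<kappa> C u" and \<kappa>: "\<kappa> 0 = k" "\<kappa> K = k" "k \<noteq> 0"
  shows "(\<forall>x\<in>layer K y 0. - vderiv u x - \<i> * k * u x = 0) \<longleftrightarrow> C 0 $ 1 = 0"
    and "(\<forall>x\<in>layer K y K. vderiv u x - \<i> * k * u x = 0) \<longleftrightarrow> C K $ 2 = 0"
proof -
  have u_eq: "u x = wave (\<kappa> m) (C m) (x - y (m - 1))" if "m \<le> K" "x \<in> layer K y m" for m x
    using u that by (simp add: piecewise_wave_def)
  have "- vderiv u x - \<i> * k * u x = 0 \<longleftrightarrow> C 0 $ 1 = 0" if "x \<in> layer K y 0" for x
    using wave_radiation(1)[OF \<kappa>(3)] vderiv_piecewise_wave[OF u, of 0] u_eq[of 0] that \<kappa> by simp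
  then show "(\<forall>x\<in>layer K y 0. - vderiv u x - \<i> * k * u x = 0) \<longleftrightarrow> C 0 $ 1 = 0"
    using outer_layers_nonempty by blast
  have "vderiv u x - \<i> * k * u x = 0 \<longleftrightarrow> C K $ 2 = 0" if "x \<in> layer K y K" for x
    using wave_radiation(2)[OF \<kappa>(3)] vderiv_piecewise_wave[OF u, of K] u_eq[of K] that \<kappa> by simp
  then show "(\<forall>x\<in>layer K y K. vderiv u x - \<i> * k * u x = 0) \<longleftrightarrow> C K $ 2 = 0"
    using outer_layers_nonempty by blast
qed

section \<open>The resonators as a layered medium\<close>

definition interface :: "(nat \<Rightarrow> real) \<Rightarrow> (nat \<Rightarrow> real) \<Rightarrow> nat \<Rightarrow> real" where
  "interface xm xp n = (if even n then xm (n div 2 + 1) else xp (n div 2 + 1))"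

lemma interface_double [simp]:
  "interface xm xp (2 * i) = xm (Suc i)" "interface xm xp (Suc (2 * i)) = xp (Suc i)"
  by (simp_all add: interface_def)

lemma nat_parity_cases:
  fixes n :: nat
  obtains i where "n = 2 * i" | i where "n = Suc (2 * i)"
  by (metis evenE oddE Suc_eq_plus1)

lemma layers_interface:
  assumes "\<And>j. j \<in> {1..N} \<Longrightarrow> xm j < xp j" "\<And>j. j \<in> {1..<N} \<Longrightarrow> xp j < xm (j + 1)"
  shows "layers (2 * N) (interface xm xp)"
proof
  fix n assume n: "Suc n < 2 * N"
  show "interface xm xp n < interface xm xp (Suc n)"
  proof (cases n rule: nat_parity_cases)
    case (1 i)
    then show ?thesis using n assms(1)[of "Suc i"] by simp
  next
    case (2 i)
    have "interface xm xp (Suc n) = xm (Suc (Suc i))"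
      using interface_double(1)[of xm xp "Suc i"] 2 by simp
    then show ?thesis using 2 n assms(2)[of "Suc i"] by simp
  qed
qed

lemma all_less_double_iff:
  fixes P :: "nat \<Rightarrow> bool"
  shows "(\<forall>n<2 * N. P n) \<longleftrightarrow> (\<forall>i<N. P (2 * i) \<and> P (Suc (2 * i)))"
proof (intro iffI allI impI)
  fix n assume *: "\<forall>i<N. P (2 * i) \<and> P (Suc (2 * i))" "n < 2 * N"
  then show "P n" by (cases n rule: nat_parity_cases) simp_all
qed simp_all

lemma ball_atLeast1_iff: "(\<forall>j\<in>{1..N}. Q j) \<longleftrightarrow> (\<forall>i<N. Q (Suc i))"
  unfolding image_Suc_lessThan[symmetric] by auto

text \<open>Inside a resonator the factor \<open>r\<close> belongs to the length in \<open>t\<close> and to the wavenumber here.\<close>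

lemma tvec_eq_interface:
  "of_real (tvec r xm xp (Suc n)) * k =
     wavenumber r k (Suc n) * of_real (interface xm xp (Suc n) - interface xm xp n)"
proof (cases n rule: nat_parity_cases)
  case (1 i)
  then show ?thesis by (simp add: tvec_def wavenumber_def)
next
  case (2 i)
  have "interface xm xp (Suc n) = xm (Suc (Suc i))"
    using interface_double(1)[of xm xp "Suc i"] 2 by simp
  then show ?thesis using 2 by (simp add: tvec_def wavenumber_def)
qed

text \<open>For the complement of the closure, a point outside it is no interface, since the endpoints of the
intervals are in the closure, so it lies in a layer; conversely, a layer is open and so avoids the
closure of every set that it avoids.\<close>

lemma resonators_eq_layers:
  assumes "layers (2 * N) (interface xm xp)"
  shows "resonators N xm xp = (\<Union>m\<in>{m. m \<le> 2 * N \<and> odd m}. layer (2 * N) (interface xm xp) m)"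
    (is "?D = ?odd")
    and "- closure (resonators N xm xp) =
      (\<Union>m\<in>{m. m \<le> 2 * N \<and> even m}. layer (2 * N) (interface xm xp) m)" (is "_ = ?even")
proof -
  interpret layers "2 * N" "interface xm xp" by fact
  have D_eq: "?D = (\<Union>i<N. {xm (Suc i)<..<xp (Suc i)})"
    unfolding resonators_def image_Suc_lessThan[symmetric] by simp
  have odd_layer: "layer (2 * N) (interface xm xp) (Suc (2 * i)) = {xm (Suc i)<..<xp (Suc i)}"
    if "i < N" for i
    using that by (auto simp: layer_def)
  have odds: "{m. m \<le> 2 * N \<and> odd m} = (\<lambda>i. Suc (2 * i)) ` {..<N}"
    by (auto elim!: oddE)
  show D: "?D = ?odd"
    unfolding odds D_eq by (simp add: odd_layer)
  show "- closure ?D = ?even"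
  proof (intro equalityI subsetI)
    fix x assume x: "x \<in> - closure ?D"
    have "xm (Suc i) \<in> closure ?D \<and> xp (Suc i) \<in> closure ?D" if i: "i < N" for i
    proof -
      have "closure {xm (Suc i)<..<xp (Suc i)} \<subseteq> closure ?D"
        unfolding D_eq using i by (intro closure_mono) auto
      moreover have "xm (Suc i) < xp (Suc i)"
        using i Suc_less[of "2 * i"] by simp
      ultimately show ?thesis by auto
    qed
    then have "\<forall>n<2 * N. interface xm xp n \<in> closure ?D"
      unfolding all_less_double_iff by simp
    then have "x \<noteq> interface xm xp n" if "n < 2 * N" for n
      using x that by blast
    then obtain m where m: "m \<le> 2 * N" "x \<in> layer (2 * N) (interface xm xp) m"
      by (rule layer_exhaust)
    moreover have "even m"
      using x m closure_subset[of ?D] unfolding D by blast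
    ultimately show "x \<in> ?even" by blast
  next
    fix x assume "x \<in> ?even"
    then obtain m where m: "m \<le> 2 * N" "even m" "x \<in> layer (2 * N) (interface xm xp) m" by blast
    have "layer (2 * N) (interface xm xp) m \<inter> ?D = {}"
      unfolding D using m(1,2) layer_unique by blast
    then have "layer (2 * N) (interface xm xp) m \<inter> closure ?D = {}"
      using open_Int_closure_eq_empty[OF open_layer] by blast
    then show "x \<in> - closure ?D" using m(3) by blast
  qed
qed

lemma helmholtz_on_UN:
  "helmholtz_on \<kappa> (\<Union>m\<in>M. S m) u \<longleftrightarrow> (\<forall>m\<in>M. helmholtz_on \<kappa> (S m) u)"
  unfolding helmholtz_on_def by blast

lemma scattering_solution_iff_layers:
  assumes L: "layers (2 * N) (interface xm xp)" and N: "N \<ge> 1" and v: "v \<noteq> 0"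
  shows "scattering_solution N xm xp v vb \<delta> (k * of_real v) u \<longleftrightarrow>
    (\<forall>m\<le>2 * N. helmholtz_on (wavenumber (v / vb) k m) (layer (2 * N) (interface xm xp) m) u) \<and>
    (\<forall>n<2 * N. transmission \<delta> n (interface xm xp n) u) \<and>
    (\<forall>x\<in>layer (2 * N) (interface xm xp) 0. - vderiv u x - \<i> * k * u x = 0) \<and>
    (\<forall>x\<in>layer (2 * N) (interface xm xp) (2 * N). vderiv u x - \<i> * k * u x = 0)"
proof -
  have k: "k * of_real v / of_real v = k" "k * of_real v / of_real vb = of_real (v / vb) * k"
    using v by simp_all
  have helmholtz: "(\<forall>m\<le>2 * N. helmholtz_on (wavenumber (v / vb) k m) (layer (2 * N) (interface xm xp) m) u) \<longleftrightarrow>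
      helmholtz_on k (- closure (resonators N xm xp)) u \<and>
      helmholtz_on (of_real (v / vb) * k) (resonators N xm xp) u"
    unfolding resonators_eq_layers(2)[OF L] unfolding resonators_eq_layers(1)[OF L] helmholtz_on_UN
    by (auto simp: wavenumber_def)
  have transmission: "(\<forall>n<2 * N. transmission \<delta> n (interface xm xp n) u) \<longleftrightarrow>
      (\<forall>j\<in>{1..N}.
          (\<forall>x\<in>{xm j, xp j}. \<exists>a. (u \<longlongrightarrow> a) (at_right x) \<and> (u \<longlongrightarrow> a) (at_left x)) \<and>
          (\<exists>b. (vderiv u \<longlongrightarrow> \<delta> * b) (at_right (xm j)) \<and> (vderiv u \<longlongrightarrow> b) (at_left (xm j))) \<and>
          (\<exists>b. (vderiv u \<longlongrightarrow> \<delta> * b) (at_left (xp j)) \<and> (vderiv u \<longlongrightarrow> b) (at_right (xp j))))"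
    unfolding all_less_double_iff ball_atLeast1_iff by (simp add: transmission_def conj_ac)
  have outer: "layer (2 * N) (interface xm xp) 0 = {..<xm 1}"
    "layer (2 * N) (interface xm xp) (2 * N) = {xp N<..}"
  proof -
    obtain M where M: "N = Suc M" using N by (cases N) simp_all
    show "layer (2 * N) (interface xm xp) 0 = {..<xm 1}"
      using N interface_double(1)[of xm xp 0] by (auto simp: layer_def)
    have "2 * N - 1 = Suc (2 * M)" using M by simp
    then show "layer (2 * N) (interface xm xp) (2 * N) = {xp N<..}"
      unfolding layer_def using M by auto
  qed
  show ?thesis
    unfolding scattering_solution_def Let_def k helmholtz transmission outer by auto
qed

section \<open>Resonant frequencies and the transfer matrix\<close>

text \<open>At \<open>n = 0\<close> the propagation matrix is \<open>L(0) = 1\<close>, because the centre of layer \<open>0\<close> is the first interface.\<close>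

lemma transfer_recursion_iff:
  fixes C :: "nat \<Rightarrow> complex^2"
  defines "T r k \<sigma> y n \<equiv> R_step \<sigma> n ** L_mat (wavenumber r k n * of_real (y n - y (n - 1)))"
  shows "(\<forall>n<K. C (Suc n) = T r k \<sigma> (interface xm xp) n *v C n) \<longleftrightarrow>
     (\<forall>n<K. C (Suc n) = R_prod (tvec r xm xp) \<sigma> k n *v C 0)"
proof -
  have T_0: "T r k \<sigma> (interface xm xp) 0 = R_prod (tvec r xm xp) \<sigma> k 0"
    unfolding R_prod_0 by (simp add: T_def L_mat_0)
  have T_Suc: "T r k \<sigma> (interface xm xp) (Suc n) ** R_prod (tvec r xm xp) \<sigma> k n =
      R_prod (tvec r xm xp) \<sigma> k (Suc n)" for n
    unfolding R_prod_Suc tvec_eq_interface by (simp add: T_def)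
  show ?thesis
  proof (intro iffI allI impI)
    fix n assume "\<forall>n<K. C (Suc n) = T r k \<sigma> (interface xm xp) n *v C n" "n < K"
    then show "C (Suc n) = R_prod (tvec r xm xp) \<sigma> k n *v C 0"
      by (induction n) (simp_all add: T_0 T_Suc matrix_vector_mul_assoc del: R_prod.simps)
  next
    fix n assume "\<forall>n<K. C (Suc n) = R_prod (tvec r xm xp) \<sigma> k n *v C 0" "n < K"
    then show "C (Suc n) = T r k \<sigma> (interface xm xp) n *v C n"
      by (cases n) (simp_all add: T_0 T_Suc matrix_vector_mul_assoc del: R_prod.simps)
  qed
qed

lemma scattering_solution_iff_amplitudes:
  assumes L: "layers (2 * N) (interface xm xp)" and N: "N \<ge> 1"
    and nz: "v > 0" "vb > 0" "k \<noteq> 0" "\<delta> \<noteq> 0" and r: "r = v / vb"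
  shows "scattering_solution N xm xp v vb \<delta> (k * of_real v) u \<longleftrightarrow>
    (\<exists>C. layers.piecewise_wave (2 * N) (interface xm xp) (wavenumber r k) C u \<and>
      (\<forall>n<2 * N. C (Suc n) = R_prod (tvec r xm xp) (\<delta> / of_real r) k n *v C 0) \<and>
      C 0 $ 1 = 0 \<and> C (2 * N) $ 2 = 0)"
proof -
  interpret layers "2 * N" "interface xm xp" by fact
  have "r \<noteq> 0" "v \<noteq> 0" using nz r by auto
  have wavenumber_nz: "wavenumber r k m \<noteq> 0" for m
    using \<open>r \<noteq> 0\<close> nz by (simp add: wavenumber_def)
  have outer: "wavenumber r k 0 = k" "wavenumber r k (2 * N) = k"
    by (simp_all add: wavenumber_def)
  let ?y = "interface xm xp"
  have conditions: "(\<forall>n<2 * N. transmission \<delta> n (?y n) u) \<and>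
      (\<forall>x\<in>layer (2 * N) ?y 0. - vderiv u x - \<i> * k * u x = 0) \<and>
      (\<forall>x\<in>layer (2 * N) ?y (2 * N). vderiv u x - \<i> * k * u x = 0) \<longleftrightarrow>
      (\<forall>n<2 * N. C (Suc n) = R_prod (tvec r xm xp) (\<delta> / of_real r) k n *v C 0) \<and>
      C 0 $ 1 = 0 \<and> C (2 * N) $ 2 = 0"
    if C: "piecewise_wave (wavenumber r k) C u" for C
  proof -
    have "(\<forall>n<2 * N. transmission \<delta> n (?y n) u) \<longleftrightarrow>
        (\<forall>n<2 * N. C (Suc n) = R_prod (tvec r xm xp) (\<delta> / of_real r) k n *v C 0)"
      unfolding transfer_recursion_iff[symmetric]
      using transmission_iff[OF C _ \<open>r \<noteq> 0\<close> nz(3,4)] by (simp add: matrix_vector_mul_assoc)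
    then show ?thesis
      unfolding radiation_iff[OF C outer nz(3)] by simp
  qed
  show ?thesis
    unfolding scattering_solution_iff_layers[OF L N \<open>v \<noteq> 0\<close>] r[symmetric]
      helmholtz_on_layers_iff[OF wavenumber_nz]
    using conditions by blast
qed

text \<open>If both amplitudes vanish on the far left, they vanish on all layers and the solution is trivial. A
non-trivial solution therefore has the far-left amplitudes \<open>(0, b)\<close> with \<open>b \<noteq> 0\<close>; for the converse \<open>b = 1\<close> is taken.\<close>

lemma resonant_frequency_iff_entry:
  assumes L: "layers (2 * N) (interface xm xp)" and N: "N \<ge> 1"
    and nz: "v > 0" "vb > 0" "k \<noteq> 0" "\<delta> \<noteq> 0" and r: "r = v / vb"
  shows "resonant_frequency N xm xp v vb \<delta> (k * of_real v) \<longleftrightarrow>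
    R_prod (tvec r xm xp) (\<delta> / of_real r) k (2 * N - 1) $ 2 $ 2 = 0"
proof -
  interpret layers "2 * N" "interface xm xp" by fact
  let ?y = "interface xm xp"
  let ?P = "R_prod (tvec r xm xp) (\<delta> / of_real r) k"
  have off_interfaces: "x \<notin> xm ` {1..N} \<union> xp ` {1..N} \<longleftrightarrow> (\<forall>n<2 * N. x \<noteq> ?y n)" for x
    unfolding all_less_double_iff image_Suc_lessThan[symmetric] by auto
  have last: "2 * N = Suc (2 * N - 1)" "2 * N - 1 < 2 * N" using N by auto
  have entry: "(?P (2 * N - 1) *v c) $ 2 = ?P (2 * N - 1) $ 2 $ 2 * c $ 2" if "c $ 1 = 0" for c
    using that by (simp add: matrix_vector_mult_def sum_2)
  note solution_iff = scattering_solution_iff_amplitudes[OF L N nz r]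
  show ?thesis
  proof
    assume "resonant_frequency N xm xp v vb \<delta> (k * of_real v)"
    then obtain u x C where C: "piecewise_wave (wavenumber r k) C u"
        "\<forall>n<2 * N. C (Suc n) = ?P n *v C 0" "C 0 $ 1 = 0" "C (2 * N) $ 2 = 0"
      and x: "\<forall>n<2 * N. x \<noteq> ?y n" "u x \<noteq> 0"
      unfolding resonant_frequency_def solution_iff off_interfaces by blast
    have "C 0 \<noteq> 0"
    proof
      assume "C 0 = 0"
      then have C_0: "C m = 0" if "m \<le> 2 * N" for m
        using C(2) that by (cases m) auto
      obtain m where m: "m \<le> 2 * N" "x \<in> layer (2 * N) ?y m"
        using layer_exhaust[of "2 * N" x ?y] x(1) by blast
      then have "u x = wave (wavenumber r k m) (C m) (x - ?y (m - 1))"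
        using C(1) by (simp add: piecewise_wave_def)
      then show False using x(2) C_0[OF m(1)] by (simp add: wave_def)
    qed
    then have "C 0 $ 2 \<noteq> 0"
      using C(3) by (simp add: vec_eq_iff forall_2)
    moreover have "C (2 * N) = ?P (2 * N - 1) *v C 0"
      using C(2) last by metis
    ultimately show "?P (2 * N - 1) $ 2 $ 2 = 0"
      using C(4) entry[OF C(3)] by simp
  next
    assume zero: "?P (2 * N - 1) $ 2 $ 2 = 0"
    define e :: "complex^2" where "e = vector [0, 1]"
    define C where "C m = (case m of 0 \<Rightarrow> e | Suc n \<Rightarrow> ?P n *v e)" for m
    obtain u where u: "piecewise_wave (wavenumber r k) C u"
      using piecewise_wave_exists by blast
    have e: "e $ 1 = 0" "e $ 2 = 1" by (simp_all add: e_def vector_2)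
    have C_0: "C 0 = e" by (simp add: C_def)
    have "C (2 * N) = ?P (2 * N - 1) *v e"
      by (subst last(1)) (simp add: C_def)
    then have "C (2 * N) $ 2 = 0" using zero entry[of e] e by simp
    then have sol: "scattering_solution N xm xp v vb \<delta> (k * of_real v) u"
      unfolding solution_iff using u e C_0 by (intro exI[of _ C]) (simp add: C_def)
    have "u (?y 0 - 1) = wave (wavenumber r k 0) (C 0) (?y 0 - 1 - ?y (0 - 1))"
      using u outer_layers_nonempty(1) unfolding piecewise_wave_def by blast
    then have "u (?y 0 - 1) = wave k e (- 1)"
      using C_0 by (simp add: wavenumber_def)
    then have "u (?y 0 - 1) \<noteq> 0"
      using e by (simp add: wave_def)
    moreover have "\<forall>n<2 * N. ?y 0 - 1 \<noteq> ?y n"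
      using layer_interfaces(2)[OF outer_layers_nonempty(1)] by blast
    ultimately show "resonant_frequency N xm xp v vb \<delta> (k * of_real v)"
      unfolding resonant_frequency_def off_interfaces using sol by blast
  qed
qed

theorem theorem3p1:
  fixes N :: nat and xm xp :: "nat \<Rightarrow> real" and v vb r :: real
    and \<delta> \<sigma> \<omega> k :: complex and t :: "nat \<Rightarrow> real"
  assumes "N \<ge> 1"
    and "\<And>j. j \<in> {1..N} \<Longrightarrow> xm j < xp j"
    and "\<And>j. j \<in> {1..<N} \<Longrightarrow> xp j < xm (j + 1)"
    and "v > 0" and "vb > 0" and "r = v / vb"
    and "\<delta> \<notin> {0, - of_real r}"
    and "\<sigma> = \<delta> / of_real r"
    and "t = tvec r xm xp"
    and "\<omega> = k * of_real v" and "\<omega> \<noteq> 0"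
  shows "(resonant_frequency N xm xp v vb \<delta> \<omega> \<longleftrightarrow> char_fun N t k \<sigma> = 0) \<and>
    (\<lambda>z. char_fun N t z \<sigma>) analytic_on UNIV \<and>
    (\<forall>z. char_fun N t z \<sigma> =
      (\<Sum>\<alpha>\<in>{1..2 * N - 1} \<rightarrow>\<^sub>E {- 1, 1 :: int}.
         (- 1) ^ (\<Sum>j=1..2 * N. j * eps (sign_ext N \<alpha> j) (sign_ext N \<alpha> (j - 1))) *
         ((1 - \<sigma>) / (1 + \<sigma>)) ^ (\<Sum>j=1..2 * N. eps (sign_ext N \<alpha> j) (sign_ext N \<alpha> (j - 1))) *
         exp (\<i> * of_real (\<Sum>j=1..2 * N - 1. of_int (\<alpha> j) * t j) * z)))"
proof -
  have "r \<noteq> 0" using assms(4-6) by simp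
  have "\<delta> \<noteq> 0" "k \<noteq> 0" using assms(7,10,11) by auto
  have \<sigma>: "\<sigma> \<noteq> 0" "1 + \<sigma> \<noteq> 0"
  proof -
    show "\<sigma> \<noteq> 0" using \<open>r \<noteq> 0\<close> \<open>\<delta> \<noteq> 0\<close> assms(8) by simp
    have "\<delta> = \<sigma> * of_real r" using \<open>r \<noteq> 0\<close> assms(8) by simp
    then show "1 + \<sigma> \<noteq> 0" using assms(7) by (auto simp: add_eq_0_iff)
  qed
  have "resonant_frequency N xm xp v vb \<delta> \<omega> \<longleftrightarrow> R_prod t \<sigma> k (2 * N - 1) $ 2 $ 2 = 0"
    unfolding assms(8-10)
    by (rule resonant_frequency_iff_entry[OF layers_interface])
      (use assms \<open>k \<noteq> 0\<close> \<open>\<delta> \<noteq> 0\<close> in auto)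
  also have "\<dots> \<longleftrightarrow> char_fun N t k \<sigma> = 0"
    using \<sigma> by (simp add: char_fun_def M_tot_def)
  finally show ?thesis
    using char_fun_analytic[OF assms(1) \<sigma>] char_fun_path_sum[OF assms(1) \<sigma>] by blast
qed

end
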